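(* Fix an integer $m\ge 2$, and let $C^d_n$ denote the number of $d$-dimensional cells (with one fewer counted when $d=0$) of the cell complex $X^m_n$ produced by the Comb Algorithm applied to $\mathrm{Ind}(\Delta^m_n)$. Take as initial conditions the values for $0\le n\le 3$: $C^d_n=0$ for all $d\ge 0$ except that, if $m=2$, $C^0_0=1$, $C^1_1=2$, $C^2_2=1$, $C^2_3=2$, and, if $m\ge 3$, $C^0_0=1$, $C^1_1=1$, $C^{m-1}_1=1$, $C^m_2=1$, $C^2_3=1$, $C^m_3=1$. Then for every $n\ge 4$ and every $d\ge 0$, $$C^d_n = C^{d-2}_{n-3} + C^{d-(m+1)}_{n-4} + C^{d-m}_{n-3},$$ where a summand is zero if its subscript or superscript is negative.
   Context: All graphs are finite and simple; $N(p)$ is the set of neighbors of $p$. $\mathrm{Ind}(G)$ is the independence complex of $G$: the simplicial complex on $V(G)$ whose faces are the independent sets of $G$ (including $\emptyset$); a face with $r$ vertices has dimension $r-1$. $Pa_\ell$ is the path on $\ell$ vertices; $\biguplus$ is disjoint union. Graphs. For $m\ge1,n\ge 1$, $Y^m_n$ is the extended star: a central vertex of degree $m$ with $m$ paths ("tendrils") of $n$ edges each emanating from it; $Y^m_0$ is a single vertex. $\widehat Y^m_n$ consists of two vertices $a,b$ joined by $m$ internally disjoint paths with $n+1$ edges each; the $k$-th vertex away from $a$ on the $j$-th path is $(j,k)$. For $n\ge 1$, $\Delta^m_n$ is $\widehat Y^m_{n+1}$ with $n$ additional vertices $1,\dots,n$ and additional edges $\{k,(j,k)\}$, $\{k,(j,k+1)\}$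 for $j\in\{1,\dots,m\}$, $k\in\{1,\dots,n\}$. Also $\Delta^m_0:=\widehat Y^m_1$ and $\Delta^m_{-1}$ is a single vertex. Matching trees. For disjoint $A,B\subseteq V(G)$ let $\Sigma(A,B)=\{I\in\mathrm{Ind}(G): A\subseteq I,\ B\cap I=\emptyset\}$. A matching tree starts with the root $\Sigma(\emptyset,\emptyset)$; as long as some leaf $\Sigma(A,B)$ has at least two elements, perform one of: (1) if some $p\in V\setminus(A\cup B)$ has $N(p)\setminus(A\cup B)=\emptyset$, give the leaf one child labeled $\emptyset$ ($p$ is a free vertex); (2) if some $p\in V\setminus(A\cup B)$ has $N(p)\setminus(A\cup B)=\{v\}$, give the leaf one child $\Sigma(A\cup\{v\},B\cup N(v))$; (3) choose $v\in V\setminus(A\cup B)$ and give the leaf two children $\Sigma(A,B\cup\{v\})$ and $\Sigma(A\cup\{v\},B\cup N(v))$. The available graph at a node is the subgraph induced on $V\setminus(A\cup B)$. The critical cells are the faces $A$ for the nonempty final leaves $\Sigma(A,B)$. By discrete Morse theory, $\mathrm{Ind}(G)$ is homotopy equivalent to a cell complex with one $d$-cell for each $d$-dimensional critical cell, plus one extra $0$-cell (the base $0$-cell, present since $\emptyset$ is matched). Trees for auxiliary graphs. Path: repeatedly apply (2) with $p$ an end vertex and $v$ its neighbor, and (1) if an isolated vertex remains. $Y^m_n$ with $n\equiv 0 \bmod 3$: on each tendril in turn apply (2) starting from its leaf ($p$ the leaf, $v$ its neighbor, and so on) until the tendril is exhausted, then apply (1) to the central vertex. $Y^m_n$ with $n\not\equiv0\bmod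 3$: apply (3) with $v$ the central vertex, then the path trees to the remaining disjoint paths. $\widehat Y^m_n$: apply (3) with $v=b$; the available graphs are then $Y^m_{n-1}$ and $Y^m_n$ (centered at $a$), to which the previous trees are applied. Comb Algorithm for $\mathrm{Ind}(\Delta^m_n)$ ($m\ge2$, $n\ge1$): for $k=1,\dots,n$ successively apply (3) with $v=k$ at $\Sigma(\emptyset,\{1,\dots,k-1\})$. Then: at $\Sigma(\{1\},N(1))$ apply (1) with $p=a$; at $\Sigma(\{k\},N(k)\cup\{1,\dots,k-1\})$ for $2\le k\le n-1$, the available graph is $Y^m_{k-1}\biguplus\Delta^m_{n-(k+1)}$, and one applies the tree of $Y^m_{k-1}$ and then, below any nonempty leaf, recursively the Comb Algorithm for $\Delta^m_{n-(k+1)}$ (the tree of $\widehat Y^m_1$ if $n-(k+1)=0$); at $\Sigma(\{n\},N(n)\cup\{1,\dots,n-1\})$ apply (1) with $p=b$; at $\Sigma(\emptyset,\{1,\dots,n\})$ the available graph is $\widehat Y^m_{n+1}$ and one applies its tree. $X^m_n$ ($n\ge1$) is the resulting cell complex, homotopy equivalent to $\mathrm{Ind}(\Delta^m_n)$; $X^m_0:=S^0$ (two $0$-cells). $C^d_n$ is the number of $d$-cells of $X^m_n$ for $d\ge1$, and $C^0_n$ is one less than the number of $0$-cells (so for $n\ge 1$, $C^d_n$ is the number of critical cells of dimension $d$); $C^d_n=0$ if $d<0$ or $n<0$. *)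

theory Defs
  imports Main "HOL-Library.Multiset"
begin

section \<open>Finite simple graphs and independence complexes\<close>

record 'v graph =
  verts :: "'v set"
  edges :: "'v set set"

definition simple_graph :: "'v graph \<Rightarrow> bool" where
  "simple_graph G \<longleftrightarrow> finite (verts G) \<and> (\<forall>e\<in>edges G. e \<subseteq> verts G \<and> card e = 2)"

definition nbs :: "'v graph \<Rightarrow> 'v \<Rightarrow> 'v set" where
  "nbs G p = {q. {p, q} \<in> edges G}"

definition Ind :: "'v graph \<Rightarrow> 'v set set" where
  "Ind G = {I. I \<subseteq> verts G \<and> (\<forall>u\<in>I. \<forall>v\<in>I. {u, v} \<notin> edges G)}"

definition face_dim :: "'v set \<Rightarrow> int" where
  "face_dim I = int (card I) - 1"


section \<open>Matching trees\<close>

definition faces_between :: "'v graph \<Rightarrow> 'v set \<Rightarrow> 'v set \<Rightarrow> 'v set set" where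
  "faces_between G A B = {I \<in> Ind G. A \<subseteq> I \<and> B \<inter> I = {}}"

text \<open>A matching tree is recorded by the operation performed at each of its nodes; the labels
  \<open>\<Sigma>(A,B)\<close> are then determined by the label of the root. \<open>Leaf\<close>: no operation;
  \<open>Free p\<close>: the single child is \<open>\<emptyset>\<close>; \<open>Force p v T\<close>: the single child
  \<open>\<Sigma>(A \<union> {v}, B \<union> N(v))\<close> carries \<open>T\<close>; \<open>Split v T U\<close>: \<open>T\<close> sits at
  \<open>\<Sigma>(A, B \<union> {v})\<close> and \<open>U\<close> at \<open>\<Sigma>(A \<union> {v}, B \<union> N(v))\<close>.\<close>

datatype 'v mtree =
    Leaf
  | Free 'v
  | Force 'v 'v "'v mtree"
  | Split 'v "'v mtree" "'v mtree"

text \<open>\<open>matching_tree G A B T\<close>: the operations of \<open>T\<close> may legally be performed from the node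
  \<open>\<Sigma>(A,B)\<close>, and none of the final leaves has two or more elements.\<close>

inductive matching_tree :: "'v graph \<Rightarrow> 'v set \<Rightarrow> 'v set \<Rightarrow> 'v mtree \<Rightarrow> bool" for G where
  Leaf: "matching_tree G A B Leaf"
    if "card (faces_between G A B) < 2"
| Free: "matching_tree G A B (Free p)"
    if "2 \<le> card (faces_between G A B)"
      "p \<in> verts G - (A \<union> B)" "nbs G p - (A \<union> B) = {}"
| Force: "matching_tree G A B (Force p v T)"
    if "2 \<le> card (faces_between G A B)"
      "p \<in> verts G - (A \<union> B)" "nbs G p - (A \<union> B) = {v}"
      "matching_tree G (A \<union> {v}) (B \<union> nbs G v) T"
| Split: "matching_tree G A B (Split v T U)"
    if "2 \<le> card (faces_between G A B)"
      "v \<in> verts G - (A \<union> B)"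
      "matching_tree G A (B \<union> {v}) T"
      "matching_tree G (A \<union> {v}) (B \<union> nbs G v) U"

primrec critical_cells :: "'v graph \<Rightarrow> 'v set \<Rightarrow> 'v set \<Rightarrow> 'v mtree \<Rightarrow> 'v set set" where
  "critical_cells G A B Leaf = (if faces_between G A B = {} then {} else {A})"
| "critical_cells G A B (Free p) = {}"
| "critical_cells G A B (Force p v T) = critical_cells G (A \<union> {v}) (B \<union> nbs G v) T"
| "critical_cells G A B (Split v T U) =
     critical_cells G A (B \<union> {v}) T \<union> critical_cells G (A \<union> {v}) (B \<union> nbs G v) U"

text \<open>\<open>graft T U\<close> continues with \<open>U\<close> below every leaf of \<open>T\<close> not labelled \<open>\<emptyset>\<close>.\<close>

primrec graft :: "'v mtree \<Rightarrow> 'v mtree \<Rightarrow> 'v mtree" where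
  "graft Leaf U = U"
| "graft (Free p) U = Free p"
| "graft (Force p v T) U = Force p v (graft T U)"
| "graft (Split v T T') U = Split v (graft T U) (graft T' U)"


section \<open>Trees for paths, extended stars and \<open>\<widehat>Y\<close>\<close>

text \<open>A path is given by the list of its vertices in order. A choice the algorithm leaves open
  (which end of a path to use, in which order to treat paths or tendrils) is left open here too, so
  these are relations. In the third rule, performing (2) with end vertex \<open>p\<close> and neighbour \<open>v\<close>
  removes \<open>p\<close>, \<open>v\<close> and the vertex after \<open>v\<close>, if any; the last rule lets either end be used.\<close>

inductive path_tree :: "'v list \<Rightarrow> 'v mtree \<Rightarrow> bool" where
  "path_tree [] Leaf"
| "path_tree [p] (Free p)"
| "path_tree (tl xs) T \<Longrightarrow> path_tree (p # v # xs) (Force p v T)"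
| "path_tree (rev xs) T \<Longrightarrow> path_tree xs T"

text \<open>A disjoint union of paths, treated one after the other in any order.\<close>

definition paths_tree :: "'v list list \<Rightarrow> 'v mtree \<Rightarrow> bool" where
  "paths_tree ps T \<longleftrightarrow>
     (\<exists>qs Ts. mset qs = mset ps \<and> list_all2 path_tree qs Ts \<and> T = foldr graft Ts Leaf)"

text \<open>Steps (2) along a tendril whose vertices are listed from its end towards the centre
  (used when their number is divisible by 3), continued with \<open>U\<close>.\<close>

fun tendril_steps :: "'v list \<Rightarrow> 'v mtree \<Rightarrow> 'v mtree" where
  "tendril_steps (p # v # w # xs) U = Force p v (tendril_steps xs U)"
| "tendril_steps _ U = U"

text \<open>\<open>star_tree n c ps T\<close>: \<open>T\<close> is a tree for the copy of \<open>Y\<^sup>m\<^sub>n\<close> with centre \<open>c\<close> and list of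
  tendrils \<open>ps\<close>; each tendril is the list of its \<open>n\<close> non-central vertices, from the centre outwards.\<close>

inductive star_tree :: "nat \<Rightarrow> 'v \<Rightarrow> 'v list list \<Rightarrow> 'v mtree \<Rightarrow> bool" for n c ps where
  "star_tree n c ps (foldr (\<lambda>q. tendril_steps (rev q)) qs (Free c))"
    if "n mod 3 = 0" "mset qs = mset ps"
| "star_tree n c ps (Split c T U)"
    if "n mod 3 \<noteq> 0" "paths_tree ps T" "paths_tree (map tl ps) U"

text \<open>\<open>Yhat_tree n a b ps T\<close>: the same for the copy of \<open>\<widehat>Y\<^sup>m\<^sub>n\<close> (\<open>n \<ge> 1\<close>) in which \<open>ps\<close> lists the
  inner vertices of the \<open>m\<close> paths, from \<open>a\<close> to \<open>b\<close>.\<close>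

inductive Yhat_tree :: "nat \<Rightarrow> 'v \<Rightarrow> 'v \<Rightarrow> 'v list list \<Rightarrow> 'v mtree \<Rightarrow> bool" for n a b ps where
  "Yhat_tree n a b ps (Split b T U)"
    if "star_tree n a ps T" "star_tree (n - 1) a (map butlast ps) U"


section \<open>The graphs \<open>\<Delta>\<^sup>m\<^sub>n\<close> and the Comb Algorithm\<close>

text \<open>\<open>Arm j k\<close> is the vertex \<open>(j,k)\<close>; \<open>Spoke k\<close> is the additional vertex \<open>k\<close>.\<close>

datatype vert = VA | VB | Arm nat nat | Spoke nat

text \<open>The definition of \<open>\<widehat>Y\<^sup>m\<^sub>n\<close> is meant for \<open>n \<ge> 1\<close>.\<close>

definition Yhat :: "nat \<Rightarrow> nat \<Rightarrow> vert graph" where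
  "Yhat m n = \<lparr>
     verts = {VA, VB} \<union> {Arm j k | j k. j \<in> {1..m} \<and> k \<in> {1..n}},
     edges = {{VA, Arm j 1} | j. j \<in> {1..m}}
           \<union> {{Arm j k, Arm j (k + 1)} | j k. j \<in> {1..m} \<and> 1 \<le> k \<and> k < n}
           \<union> {{Arm j n, VB} | j. j \<in> {1..m}} \<rparr>"

definition Delta :: "nat \<Rightarrow> nat \<Rightarrow> vert graph" where
  "Delta m n = \<lparr>
     verts = verts (Yhat m (n + 1)) \<union> {Spoke k | k. k \<in> {1..n}},
     edges = edges (Yhat m (n + 1))
           \<union> {{Spoke k, Arm j k} | j k. j \<in> {1..m} \<and> k \<in> {1..n}}
           \<union> {{Spoke k, Arm j (k + 1)} | j k. j \<in> {1..m} \<and> k \<in> {1..n}} \<rparr>"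

definition arms :: "nat \<Rightarrow> nat \<Rightarrow> vert list list" where
  "arms m n = map (\<lambda>j. map (Arm j) [1..<n+1]) [1..<m+1]"

text \<open>Once \<open>k\<close> has been selected and \<open>1, \<dots>, k - 1\<close> discarded, the component of the available
  graph containing \<open>b\<close> is a copy of \<open>\<Delta>\<^sup>m\<^bsub>n - (k + 1)\<^esub>\<close> whose vertex \<open>a\<close> is the additional
  vertex \<open>k + 1\<close>. The following map identifies the two.\<close>

fun shift :: "nat \<Rightarrow> vert \<Rightarrow> vert" where
  "shift k VA = Spoke (k + 1)"
| "shift k VB = VB"
| "shift k (Arm j i) = Arm j (i + (k + 1))"
| "shift k (Spoke i) = Spoke (i + (k + 1))"

text \<open>\<open>comb_branch m n k T\<close>: \<open>T\<close> is a tree as used at \<open>\<Sigma>({k}, N(k) \<union> {1, \<dots>, k - 1})\<close> in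
  \<open>\<Delta>\<^sup>m\<^sub>n\<close>. For \<open>n = 1\<close> the instructions for \<open>k = 1\<close> and for \<open>k = n\<close> both apply, and either may be
  followed. \<open>comb_tree m 0\<close> is the tree of \<open>\<widehat>Y\<^sup>m\<^sub>1 = \<Delta>\<^sup>m\<^sub>0\<close>, needed only inside the recursion.\<close>

inductive comb_tree :: "nat \<Rightarrow> nat \<Rightarrow> vert mtree \<Rightarrow> bool"
  and comb_branch :: "nat \<Rightarrow> nat \<Rightarrow> nat \<Rightarrow> vert mtree \<Rightarrow> bool"
  for m where
  comb_0: "comb_tree m 0 R"
    if "Yhat_tree 1 VA VB (arms m 1) R"
| comb: "comb_tree m n (foldr (\<lambda>k U. Split (Spoke k) U (D k)) [1..<n+1] R)"
    if "1 \<le> n" "\<forall>k\<in>{1..n}. comb_branch m n k (D k)" "Yhat_tree (n + 1) VA VB (arms m (n + 1)) R"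
| first: "comb_branch m n 1 (Free VA)"
    if "1 \<le> n"
| last: "comb_branch m n n (Free VB)"
    if "1 \<le> n"
| middle: "comb_branch m n k (graft T (map_mtree (shift k) R))"
    if "2 \<le> k" "k < n" "star_tree (k - 1) VA (arms m (k - 1)) T" "comb_tree m (n - (k + 1)) R"

definition comb_matching_tree :: "nat \<Rightarrow> nat \<Rightarrow> vert mtree \<Rightarrow> bool" where
  "comb_matching_tree m n T \<longleftrightarrow> matching_tree (Delta m n) {} {} T \<and> comb_tree m n T"


section \<open>The cells of \<open>X\<^sup>m\<^sub>n\<close>\<close>

text \<open>\<open>T n\<close> is the matching tree that the Comb Algorithm has produced for \<open>\<Delta>\<^sup>m\<^sub>n\<close>
  (\<open>n \<ge> 1\<close>). Only the cells of \<open>X\<^sup>m\<^sub>n\<close> and their dimensions are recorded, not the attaching maps;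
  \<open>X\<^sup>m\<^sub>0\<close> is \<open>S\<^sup>0\<close> by convention.\<close>

datatype cell = Base | Critical "vert set"

fun cell_dim :: "cell \<Rightarrow> int" where
  "cell_dim Base = 0"
| "cell_dim (Critical A) = face_dim A"

definition X_num_cells :: "nat \<Rightarrow> (nat \<Rightarrow> vert mtree) \<Rightarrow> int \<Rightarrow> nat \<Rightarrow> nat" where
  "X_num_cells m T d n =
     (if n = 0 then (if d = 0 then 2 else 0)
      else card {c \<in> insert Base (Critical ` critical_cells (Delta m n) {} {} (T n)).
                   cell_dim c = d})"

definition C :: "nat \<Rightarrow> (nat \<Rightarrow> vert mtree) \<Rightarrow> int \<Rightarrow> int \<Rightarrow> int" where
  "C m T d n =
     (if d < 0 \<or> n < 0 then 0
      else int (X_num_cells m T d (nat n)) - (if d = 0 then 1 else 0))"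

section \<open>The Comb Algorithm yields matching trees\<close>

text \<open>The side conditions of the matching tree operations hold throughout the Comb Algorithm,
  whatever choices are made (\<open>comb_tree_imp_matching_tree\<close>), and it can always be carried out
  (\<open>exists_comb_matching_tree\<close>).\<close>

lemma simple_Delta: "simple_graph (Delta m n)"
proof -
  have "{Arm j k |j k. j \<in> {1..m} \<and> k \<in> {1..n + 1}} = (\<lambda>(j,k). Arm j k) ` ({1..m} \<times> {1..n+1})"
    "{Spoke k |k. k \<in> {1..n}} = Spoke ` {1..n}"
    by auto
  then have "finite (verts (Delta m n))"
    by (simp add: Delta_def Yhat_def)
  then show ?thesis
    by (auto simp: simple_graph_def Delta_def Yhat_def)
qed

lemma exists_path_tree: "\<exists>T. path_tree xs T"
proof (induction xs rule: length_induct)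
  case (1 xs)
  show ?case
  proof (cases xs)
    case Nil
    then show ?thesis by (auto intro: path_tree.intros)
  next
    case (Cons p ys)
    show ?thesis
    proof (cases ys)
      case Nil
      then show ?thesis using Cons by (auto intro: path_tree.intros)
    next
      case c: (Cons v zs)
      have "length (tl zs) < length xs" using c Cons by simp
      with 1 c Cons show ?thesis by (blast intro: path_tree.intros)
    qed
  qed
qed

lemma exists_paths_tree: "\<exists>T. paths_tree ps T"
proof -
  have "list_all2 path_tree ps (map (\<lambda>p. SOME T. path_tree p T) ps)"
    by (simp add: list_all2_conv_all_nth someI_ex[OF exists_path_tree])
  then show ?thesis unfolding paths_tree_def by blast
qed

lemma exists_star_tree: "\<exists>T. star_tree n c ps T"
  by (metis star_tree.intros exists_paths_tree)

lemma exists_Yhat_tree: "\<exists>T. Yhat_tree n a b ps T"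
  by (metis Yhat_tree.intros exists_star_tree)

lemma exists_comb_tree: "\<exists>T. comb_tree m n T"
proof (induction n rule: less_induct)
  case (less n)
  show ?case
  proof (cases "n = 0")
    case True
    then show ?thesis by (metis comb_0 exists_Yhat_tree)
  next
    case False
    have "\<exists>T. comb_branch m n k T" if k: "k \<in> {1..n}" for k
    proof -
      consider "k = 1" | "k = n" | "2 \<le> k" "k < n" using k by force
      then show ?thesis
      proof cases
        case 3
        then have "n - (k + 1) < n" by simp
        with less obtain R where "comb_tree m (n - (k + 1)) R" by blast
        with 3 show ?thesis by (metis middle exists_star_tree)
      qed (use False first[of n m] last[of n m] in auto)
    qed
    then obtain D where "\<forall>k\<in>{1..n}. comb_branch m n k (D k)" by metis
    moreover obtain R where "Yhat_tree (n + 1) VA VB (arms m (n + 1)) R"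
      using exists_Yhat_tree by metis
    ultimately show ?thesis using False comb[of n m D R] by auto
  qed
qed

text \<open>\<open>tree_on G W W' T\<close>: the operations of \<open>T\<close> are legal when the available graph has
  vertex set \<open>W\<close>, and at each leaf not labelled \<open>\<emptyset>\<close> the set \<open>W'\<close> is still available.\<close>

primrec tree_on :: "'v graph \<Rightarrow> 'v set \<Rightarrow> 'v set \<Rightarrow> 'v mtree \<Rightarrow> bool" where
  "tree_on G W W' Leaf \<longleftrightarrow> W = W'"
| "tree_on G W W' (Free p) \<longleftrightarrow> p \<in> W \<and> nbs G p \<inter> W = {}"
| "tree_on G W W' (Force p v T) \<longleftrightarrow>
     p \<in> W \<and> nbs G p \<inter> W = {v} \<and> tree_on G (W - insert v (nbs G v)) W' T"
| "tree_on G W W' (Split v T U) \<longleftrightarrow>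
     v \<in> W \<and> tree_on G (W - {v}) W' T \<and> tree_on G (W - insert v (nbs G v)) W' U"

lemma tree_on_graft:
  "tree_on G W W' T \<Longrightarrow> tree_on G W' W'' U \<Longrightarrow> tree_on G W W'' (graft T U)"
  by (induction T arbitrary: W) auto

lemma two_le_card_faces:
  assumes "simple_graph G" "A \<in> Ind G" "A \<inter> B = {}" "\<forall>u\<in>A. nbs G u \<subseteq> B"
    "p \<in> verts G - (A \<union> B)"
  shows "2 \<le> card (faces_between G A B)"
proof -
  have ns: "{p} \<notin> edges G" using assms(1) by (force simp: simple_graph_def)
  have "A \<union> {p} \<in> Ind G"
    using assms ns by (auto simp: Ind_def nbs_def insert_commute)
  then have "{A, A \<union> {p}} \<subseteq> faces_between G A B"
    using assms by (auto simp: faces_between_def)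
  moreover have "finite (faces_between G A B)"
    by (rule finite_subset[of _ "Pow (verts G)"])
      (use assms(1) in \<open>auto simp: faces_between_def Ind_def simple_graph_def\<close>)
  moreover have "A \<noteq> A \<union> {p}" using assms(5) by blast
  then have "card {A, A \<union> {p}} = 2" by simp
  ultimately show ?thesis by (metis card_mono)
qed

lemma tree_on_imp_matching_tree:
  assumes "simple_graph G" "A \<in> Ind G" "A \<inter> B = {}" "\<forall>u\<in>A. nbs G u \<subseteq> B"
    "tree_on G (verts G - (A \<union> B)) {} T"
  shows "matching_tree G A B T"
  using assms(2-)
proof (induction T arbitrary: A B)
  case Leaf
  then have "faces_between G A B \<subseteq> {A}"
    by (auto simp: faces_between_def Ind_def)
  then have "card (faces_between G A B) \<le> 1"
    using card_mono[of "{A}" "faces_between G A B"] by simp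
  then show ?case by (auto intro: matching_tree.intros)
next
  case (Free p)
  have "nbs G p \<subseteq> verts G" using assms(1) by (auto simp: simple_graph_def nbs_def)
  with Free two_le_card_faces[OF assms(1) Free(1-3), of p] show ?case
    by (intro matching_tree.Free) auto
next
  case (Force p v T)
  have nv: "nbs G q \<subseteq> verts G" for q using assms(1) by (auto simp: simple_graph_def nbs_def)
  have ns: "{q} \<notin> edges G" for q using assms(1) by (force simp: simple_graph_def)
  have v: "v \<in> verts G - (A \<union> B)" using Force by auto
  have "A \<union> {v} \<in> Ind G" "(A \<union> {v}) \<inter> (B \<union> nbs G v) = {}"
    using Force.prems v ns by (auto simp: Ind_def nbs_def insert_commute)
  moreover have "verts G - (A \<union> {v} \<union> (B \<union> nbs G v)) = verts G - (A \<union> B) - insert v (nbs G v)"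
    by auto
  ultimately have "matching_tree G (A \<union> {v}) (B \<union> nbs G v) T"
    using Force by (intro Force.IH) auto
  with Force.prems two_le_card_faces[OF assms(1) Force.prems(1-3), of p] nv[of p] show ?case
    by (intro matching_tree.Force) auto
next
  case (Split v T U)
  have ns: "{q} \<notin> edges G" for q using assms(1) by (force simp: simple_graph_def)
  have v: "v \<in> verts G - (A \<union> B)" using Split by auto
  have "A \<union> {v} \<in> Ind G" "(A \<union> {v}) \<inter> (B \<union> nbs G v) = {}"
    using Split.prems v ns by (auto simp: Ind_def nbs_def insert_commute)
  moreover have "verts G - (A \<union> {v} \<union> (B \<union> nbs G v)) = verts G - (A \<union> B) - insert v (nbs G v)"
    by auto
  ultimately have "matching_tree G (A \<union> {v}) (B \<union> nbs G v) U"
    using Split by (intro Split.IH(2)) auto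
  moreover have "verts G - (A \<union> (B \<union> {v})) = verts G - (A \<union> B) - {v}" by auto
  then have "matching_tree G A (B \<union> {v}) T"
    using Split v by (intro Split.IH(1)) auto
  ultimately show ?case
    using two_le_card_faces[OF assms(1) Split.prems(1-3) v] v
    by (intro matching_tree.Split) auto
qed

definition adj :: "'v graph \<Rightarrow> 'v \<Rightarrow> 'v \<Rightarrow> bool" where
  "adj G u v \<longleftrightarrow> {u, v} \<in> edges G"

lemma adj_sym: "adj G u v = adj G v u"
  by (simp add: adj_def insert_commute)

lemma in_nbs [simp]: "q \<in> nbs G p \<longleftrightarrow> adj G p q"
  by (simp add: adj_def nbs_def)

lemma tree_on_map:
  assumes "tree_on G W W' T" "inj_on f W" "\<forall>u\<in>W. \<forall>v\<in>W. adj H (f u) (f v) = adj G u v"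
  shows "tree_on H (f ` W) (f ` W') (map_mtree f T)"
  using assms
proof (induction T arbitrary: W)
  case (Free p)
  then show ?case by auto
next
  case (Force p v T)
  have v: "p \<in> W" "v \<in> W" using Force.prems by auto
  have n: "nbs H (f u) \<inter> f ` W = f ` (nbs G u \<inter> W)" if "u \<in> W" for u
    using Force.prems that by auto
  have "f ` W - insert (f v) (nbs H (f v)) = f ` (W - insert v (nbs G v))"
    using Force.prems(2,3) v by (auto simp: inj_on_def)
  moreover have "tree_on H (f ` (W - insert v (nbs G v))) (f ` W') (map_mtree f T)"
    using Force.prems by (intro Force.IH) (auto intro: inj_on_subset)
  ultimately show ?case using n[of p] v Force.prems by simp
next
  case (Split v T U)
  have v: "v \<in> W" using Split.prems by auto
  have "f ` W - insert (f v) (nbs H (f v)) = f ` (W - insert v (nbs G v))"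
    "f ` W - {f v} = f ` (W - {v})"
    using Split.prems(2,3) v by (auto simp: inj_on_def)
  moreover have "tree_on H (f ` (W - insert v (nbs G v))) (f ` W') (map_mtree f U)"
    "tree_on H (f ` (W - {v})) (f ` W') (map_mtree f T)"
    using Split.prems by (intro Split.IH; auto intro: inj_on_subset)+
  ultimately show ?case using v by simp
qed auto

definition ipath :: "'v graph \<Rightarrow> 'v list \<Rightarrow> bool" where
  "ipath G xs \<longleftrightarrow> distinct xs \<and> (\<forall>i<length xs. \<forall>j<length xs.
     adj G (xs ! i) (xs ! j) \<longleftrightarrow> i = Suc j \<or> j = Suc i)"

definition sep :: "'v graph \<Rightarrow> 'v set \<Rightarrow> 'v set \<Rightarrow> bool" where
  "sep G S W \<longleftrightarrow> (\<forall>x\<in>S. \<forall>w\<in>W. x \<noteq> w \<and> \<not> adj G x w)"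

lemma ipath_rev: "ipath G (rev xs) \<longleftrightarrow> ipath G xs"
proof -
  have *: "ipath G (rev ys)" if "ipath G ys" for ys :: "'a list"
    unfolding ipath_def
  proof (intro conjI allI impI)
    show "distinct (rev ys)" using that by (simp add: ipath_def)
    fix i j assume "i < length (rev ys)" "j < length (rev ys)"
    with that show "adj G (rev ys ! i) (rev ys ! j) \<longleftrightarrow> i = Suc j \<or> j = Suc i"
      by (auto simp: ipath_def rev_nth)
  qed
  show ?thesis using *[of xs] *[of "rev xs"] by auto
qed

lemma ipath_drop: "ipath G xs \<Longrightarrow> ipath G (drop k xs)"
  by (auto simp: ipath_def)

lemma ipath_take: "ipath G xs \<Longrightarrow> ipath G (take k xs)"
  by (auto simp: ipath_def)

lemma ipath_tl: "ipath G xs \<Longrightarrow> ipath G (tl xs)"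
  by (metis ipath_drop drop_Suc drop0)

lemma ipath_butlast: "ipath G xs \<Longrightarrow> ipath G (butlast xs)"
  by (simp add: butlast_conv_take ipath_take)

lemma ipath_Cons2:
  assumes "ipath G (p # v # xs)"
  shows "adj G p v" "adj G v p" "\<not> adj G p p" "\<not> adj G v v" "\<forall>x\<in>set xs. \<not> adj G p x"
    "p \<noteq> v" "p \<notin> set xs" "v \<notin> set xs" "\<forall>x\<in>set (tl xs). \<not> adj G v x"
    "xs \<noteq> [] \<Longrightarrow> adj G v (hd xs)"
proof -
  have a: "adj G ((p#v#xs) ! i) ((p#v#xs) ! j) \<longleftrightarrow> i = Suc j \<or> j = Suc i"
    if "i < length xs + 2" "j < length xs + 2" for i j
    using assms that by (auto simp: ipath_def)
  show "adj G p v" "adj G v p" "\<not> adj G p p" "\<not> adj G v v"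
    using a[of 0 1] a[of 1 0] a[of 0 0] a[of 1 1] by auto
  show "\<forall>x\<in>set xs. \<not> adj G p x"
    using a[of 0 "Suc (Suc _)"] by (auto simp: in_set_conv_nth)
  show "p \<noteq> v" "p \<notin> set xs" "v \<notin> set xs" using assms by (auto simp: ipath_def)
  show "\<forall>x\<in>set (tl xs). \<not> adj G v x"
    using a[of 1 "Suc (Suc (Suc _))"] by (auto simp: in_set_conv_nth nth_tl)
  show "adj G v (hd xs)" if "xs \<noteq> []"
    using a[of 1 2] that by (cases xs) auto
qed

lemma tree_on_path:
  "path_tree xs T \<Longrightarrow> ipath G xs \<Longrightarrow> sep G (set xs) W \<Longrightarrow> tree_on G (set xs \<union> W) W T"
proof (induction rule: path_tree.induct)
  case (2 p)
  then show ?case by (auto simp: ipath_def sep_def)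
next
  case (3 xs T p v)
  note c = ipath_Cons2[OF 3(3)]
  have *: "set (p # v # xs) \<union> W - insert v (nbs G v) = set (tl xs) \<union> W"
  proof (cases xs)
    case Nil
    then show ?thesis using c 3(4) by (auto simp: sep_def)
  next
    case (Cons w ys)
    then have "w \<notin> set ys" using 3(3) by (auto simp: ipath_def)
    then show ?thesis using c 3(4) Cons by (auto simp: sep_def)
  qed
  have "tree_on G (set (tl xs) \<union> W) W T"
  proof (rule 3(2))
    show "ipath G (tl xs)" using ipath_drop[OF 3(3), of 3] by (simp add: numeral_eq_Suc drop_Suc)
    show "sep G (set (tl xs)) W" using 3(4) by (cases xs) (auto simp: sep_def)
  qed
  moreover have "nbs G p \<inter> (set (p # v # xs) \<union> W) = {v}"
    using c 3(4) by (auto simp: sep_def)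
  ultimately show ?case using * by simp
qed (auto simp: ipath_rev)

text \<open>Lists of disjoint paths without edges between different ones.\<close>

definition paths_sep :: "'v graph \<Rightarrow> 'v list list \<Rightarrow> bool" where
  "paths_sep G ps \<longleftrightarrow> (\<forall>p\<in>set ps. ipath G p) \<and> distinct (concat ps) \<and>
     (\<forall>p\<in>set ps. \<forall>q\<in>set ps. p \<noteq> q \<longrightarrow> sep G (set p) (set q))"

lemma paths_sep_mset:
  assumes "mset qs = mset ps" "paths_sep G ps"
  shows "paths_sep G qs" "set qs = set ps"
proof -
  show s: "set qs = set ps" using assms(1) by (metis set_mset_mset)
  have "mset (concat qs) = mset (concat ps)" using assms(1) by (metis mset_concat mset_map sum_mset_sum_list)
  then have "distinct (concat qs) = distinct (concat ps)" by (rule mset_eq_imp_distinct_iff)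
  with assms(2) s show "paths_sep G qs" by (simp add: paths_sep_def)
qed

lemma paths_sep_Cons:
  assumes "paths_sep G (p # ps)"
  shows "ipath G p" "paths_sep G ps" "sep G (set p) (\<Union>(set ` set ps))"
proof -
  show "ipath G p" "paths_sep G ps" using assms by (auto simp: paths_sep_def)
  have "sep G (set p) (set q)" if "q \<in> set ps" for q
  proof (cases "p = q")
    case True
    have "set p \<inter> set q = {}" using assms that by (auto simp: paths_sep_def)
    then show ?thesis using True by (simp add: sep_def)
  next
    case False
    then show ?thesis using assms that by (simp add: paths_sep_def)
  qed
  then show "sep G (set p) (\<Union>(set ` set ps))" by (auto simp: sep_def)
qed

lemma tree_on_paths:
  assumes "paths_tree ps T" "paths_sep G ps" "sep G (\<Union>(set ` set ps)) W"
  shows "tree_on G (\<Union>(set ` set ps) \<union> W) W T"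
proof -
  obtain qs Ts where q: "mset qs = mset ps" "list_all2 path_tree qs Ts" "T = foldr graft Ts Leaf"
    using assms(1) by (auto simp: paths_tree_def)
  have "tree_on G (\<Union>(set ` set qs) \<union> W) W (foldr graft Ts Leaf)"
    if "list_all2 path_tree qs Ts" "paths_sep G qs" "sep G (\<Union>(set ` set qs)) W" for qs
    using that
  proof (induction rule: list_all2_induct)
    case (Cons p qs T Ts)
    note c = paths_sep_Cons[OF Cons(4)]
    have "tree_on G (set p \<union> (\<Union>(set ` set qs) \<union> W)) (\<Union>(set ` set qs) \<union> W) T"
      using c Cons by (intro tree_on_path) (auto simp: sep_def)
    moreover have "tree_on G (\<Union>(set ` set qs) \<union> W) W (foldr graft Ts Leaf)"
      using c Cons by (auto simp: sep_def)
    ultimately show ?case by (auto simp: Un_assoc intro: tree_on_graft)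
  qed auto
  with q assms paths_sep_mset[OF q(1) assms(2)] show ?thesis by metis
qed

lemma tree_on_tendril:
  "\<lbrakk>length xs mod 3 = 0; ipath G xs; set xs \<inter> W = {}; \<forall>x\<in>set (butlast xs). \<forall>w\<in>W. \<not> adj G x w;
    tree_on G W W' U\<rbrakk> \<Longrightarrow> tree_on G (set xs \<union> W) W' (tendril_steps xs U)"
proof (induction xs U rule: tendril_steps.induct)
  case (1 p v w xs U)
  note c = ipath_Cons2[OF 1(3)]
  have w: "w \<notin> set xs" using 1(3) by (auto simp: ipath_def)
  have pv: "\<forall>u\<in>W. \<not> adj G p u \<and> \<not> adj G v u" using 1(5) by auto
  have "set (p # v # w # xs) \<union> W - insert v (nbs G v) = set xs \<union> W"
    using c w 1(4) pv by auto
  moreover have "nbs G p \<inter> (set (p # v # w # xs) \<union> W) = {v}"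
    using c pv by auto
  moreover have "tree_on G (set xs \<union> W) W' (tendril_steps xs U)"
  proof (rule 1(1))
    show "length xs mod 3 = 0" using 1(2) by (simp add: mod_Suc split: if_splits)
    show "ipath G xs" using ipath_drop[OF 1(3), of 3] by (simp add: numeral_eq_Suc)
    show "\<forall>x\<in>set (butlast xs). \<forall>u\<in>W. \<not> adj G x u" using 1(5) by (cases "xs = []") auto
  qed (use 1 in auto)
  ultimately show ?case by simp
qed auto

lemma in_set_butlastD2: "x \<in> set (butlast (rev q)) \<Longrightarrow> x \<in> set (tl q)"
  by (metis butlast_rev set_rev)

lemma tree_on_star:
  assumes T: "star_tree n c ps T" and len: "\<forall>p\<in>set ps. length p = n"
    and ps: "paths_sep G ps" and c: "\<not> adj G c c" "c \<notin> \<Union>(set ` set ps)"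
    and adj: "\<forall>p\<in>set ps. p \<noteq> [] \<longrightarrow> adj G c (hd p) \<and> (\<forall>x\<in>set (tl p). \<not> adj G c x)"
    and W: "sep G (insert c (\<Union>(set ` set ps))) W"
  shows "tree_on G (insert c (\<Union>(set ` set ps)) \<union> W) W T"
  using T
proof cases
  case (1 qs)
  have "tree_on G (insert c (\<Union>(set ` set qs)) \<union> W) W (foldr (\<lambda>q. tendril_steps (rev q)) qs (Free c))"
    if "paths_sep G qs" "set qs \<subseteq> set ps" for qs
    using that
  proof (induction qs)
    case Nil
    then show ?case using c W by (auto simp: sep_def)
  next
    case (Cons q qs)
    note s = paths_sep_Cons[OF Cons(2)]
    have "tree_on G (set (rev q) \<union> (insert c (\<Union>(set ` set qs)) \<union> W)) W
        (tendril_steps (rev q) (foldr (\<lambda>q. tendril_steps (rev q)) qs (Free c)))"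
    proof (rule tree_on_tendril)
      show "length (rev q) mod 3 = 0" using Cons len 1 by auto
      show "ipath G (rev q)" using s by (simp add: ipath_rev)
      show "set (rev q) \<inter> (insert c (\<Union> (set ` set qs)) \<union> W) = {}"
        using s(3) c(2) W Cons(3) by (fastforce simp: sep_def)
      show "\<forall>x\<in>set (butlast (rev q)). \<forall>w\<in>insert c (\<Union> (set ` set qs)) \<union> W. \<not> adj G x w"
      proof (intro ballI)
        fix x w assume x: "x \<in> set (butlast (rev q))" and w: "w \<in> insert c (\<Union> (set ` set qs)) \<union> W"
        have x1: "x \<in> set (tl q)" "x \<in> set q" "q \<noteq> []" "q \<in> set ps"
          using in_set_butlastD2[OF x] Cons(3) by (cases q; auto)+
        consider "w = c" | "w \<in> \<Union> (set ` set qs)" | "w \<in> W" using w by auto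
        then show "\<not> adj G x w"
        proof cases
          case 1
          then show ?thesis using adj x1 adj_sym[of G x c] by auto
        next
          case 2
          then show ?thesis using s(3) x1 by (auto simp: sep_def)
        next
          case 3
          then show ?thesis using W x1 by (auto simp: sep_def)
        qed
      qed
      show "tree_on G (insert c (\<Union> (set ` set qs)) \<union> W) W
          (foldr (\<lambda>q. tendril_steps (rev q)) qs (Free c))"
        using Cons s by auto
    qed
    then show ?case by (simp add: Un_assoc Un_left_commute insert_commute)
  qed
  with 1 paths_sep_mset[OF 1(3) ps] show ?thesis by (metis order_refl)
next
  case (2 T U)
  let ?S = "\<Union>(set ` set ps)"
  have n: "p \<noteq> []" if "p \<in> set ps" for p using that 2 len by fastforce
  have "tree_on G (?S \<union> W) W T"
    using 2 ps W by (intro tree_on_paths) (auto simp: sep_def)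
  moreover have "insert c ?S \<union> W - {c} = ?S \<union> W" using c W by (auto simp: sep_def)
  moreover have "insert c ?S \<union> W - insert c (nbs G c) = \<Union>(set ` set (map tl ps)) \<union> W"
  proof -
    have p: "set p - nbs G c = set (tl p)" if "p \<in> set ps" for p
    proof -
      have "p = hd p # tl p" using n that by simp
      moreover have "distinct p" using ps that by (auto simp: paths_sep_def ipath_def)
      ultimately have "set p = insert (hd p) (set (tl p))" "hd p \<notin> set (tl p)"
        by (metis list.simps(15), metis distinct.simps(2))
      then show ?thesis using adj that n by auto
    qed
    have "insert c ?S \<union> W - insert c (nbs G c) = (\<Union>p\<in>set ps. set p - nbs G c) \<union> W"
      using c W by (auto simp: sep_def)
    then show ?thesis using p by simp
  qed
  moreover have "tree_on G (\<Union>(set ` set (map tl ps)) \<union> W) W U"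
  proof (rule tree_on_paths)
    have tl: "set (tl p) \<subseteq> set p" for p :: "'a list" by (cases p) auto
    have "distinct (concat (map tl qs))" if "distinct (concat qs)" for qs :: "'a list list"
      using that tl by (induction qs) (auto simp: distinct_tl, blast)
    moreover have "sep G (set (tl p)) (set (tl q))" if "sep G (set p) (set q)" for p q
      using that tl[of p] tl[of q] by (auto simp: sep_def)
    moreover have "sep G (set (tl p)) (set (tl q))" if "tl p \<noteq> tl q" "p \<in> set ps" "q \<in> set ps" for p q
      using calculation(2) that ps by (metis paths_sep_def)
    ultimately show "paths_sep G (map tl ps)"
      using ps by (auto simp: paths_sep_def ipath_tl)
    show "sep G (\<Union> (set ` set (map tl ps))) W" using W tl by (fastforce simp: sep_def)
  qed (use 2 in simp)
  ultimately show ?thesis using 2 by simp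
qed

lemma adj_Delta [simp]:
  "\<not> adj (Delta m n) VA VA" "\<not> adj (Delta m n) VB VB" "\<not> adj (Delta m n) VA VB" "\<not> adj (Delta m n) VB VA"
  "\<not> adj (Delta m n) VA (Spoke k)" "\<not> adj (Delta m n) (Spoke k) VA"
  "\<not> adj (Delta m n) VB (Spoke k)" "\<not> adj (Delta m n) (Spoke k) VB"
  "\<not> adj (Delta m n) (Spoke k) (Spoke l)"
  "adj (Delta m n) VA (Arm j k) \<longleftrightarrow> j \<in> {1..m} \<and> k = 1"
  "adj (Delta m n) (Arm j k) VA \<longleftrightarrow> j \<in> {1..m} \<and> k = 1"
  "adj (Delta m n) VB (Arm j k) \<longleftrightarrow> j \<in> {1..m} \<and> k = n + 1"
  "adj (Delta m n) (Arm j k) VB \<longleftrightarrow> j \<in> {1..m} \<and> k = n + 1"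
  "adj (Delta m n) (Spoke l) (Arm j k) \<longleftrightarrow> j \<in> {1..m} \<and> l \<in> {1..n} \<and> (k = l \<or> k = l + 1)"
  "adj (Delta m n) (Arm j k) (Spoke l) \<longleftrightarrow> j \<in> {1..m} \<and> l \<in> {1..n} \<and> (k = l \<or> k = l + 1)"
  by (auto simp: adj_def Delta_def Yhat_def doubleton_eq_iff)

lemma adj_Delta_Arm [simp]:
  "adj (Delta m n) (Arm j k) (Arm i l) \<longleftrightarrow>
     i = j \<and> j \<in> {1..m} \<and> 1 \<le> k \<and> 1 \<le> l \<and> k \<le> n + 1 \<and> l \<le> n + 1 \<and> (k = l + 1 \<or> l = k + 1)"
proof -
  have "adj (Delta m n) (Arm j k) (Arm i l) \<longleftrightarrow> i = j \<and> j \<in> {1..m} \<and>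
      ((l = k + 1 \<and> 1 \<le> k \<and> k < n + 1) \<or> (k = l + 1 \<and> 1 \<le> l \<and> l < n + 1))"
    unfolding adj_def Delta_def Yhat_def by (simp add: doubleton_eq_iff, blast)
  then show ?thesis by auto
qed

lemma set_arms: "\<Union>(set ` set (arms m n)) = {Arm j k | j k. j \<in> {1..m} \<and> k \<in> {1..n}}"
  by (fastforce simp: arms_def)

lemma paths_sep_arms:
  assumes "l \<le> n + 1"
  shows "paths_sep (Delta m n) (arms m l)"
  unfolding paths_sep_def
proof (intro conjI ballI impI)
  fix p assume "p \<in> set (arms m l)"
  then have "\<exists>j\<in>{1..m}. p = map (Arm j) [1..<l+1]"
    unfolding arms_def by (force simp del: upt_Suc map_eq_conv)
  then obtain j where "j \<in> {1..m}" "p = map (Arm j) [1..<l+1]" by blast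
  then show "ipath (Delta m n) p"
    using assms by (auto simp: ipath_def distinct_map inj_on_def simp del: upt_Suc)
next
  have "distinct (concat (map (\<lambda>j. map (Arm j) [1..<l+1]) js))" if "distinct js" for js
    using that by (induction js) (auto simp: distinct_map inj_on_def simp del: upt_Suc)
  then show "distinct (concat (arms m l))" by (simp add: arms_def del: upt_Suc)
next
  fix p q assume "p \<in> set (arms m l)" "q \<in> set (arms m l)" "p \<noteq> q"
  then show "sep (Delta m n) (set p) (set q)"
    by (auto simp: arms_def sep_def simp del: upt_Suc)
qed

lemma tree_on_star_arms:
  assumes "star_tree l VA (arms m l) T" "l \<le> n + 1"
    "sep (Delta m n) (insert VA {Arm j k | j k. j \<in> {1..m} \<and> k \<in> {1..l}}) W"
  shows "tree_on (Delta m n) (insert VA {Arm j k | j k. j \<in> {1..m} \<and> k \<in> {1..l}} \<union> W) W T"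
  unfolding set_arms[symmetric]
proof (rule tree_on_star[OF assms(1)])
  show "\<forall>p\<in>set (arms m l). length p = l" by (auto simp: arms_def)
  show "\<forall>p\<in>set (arms m l). p \<noteq> [] \<longrightarrow> adj (Delta m n) VA (hd p) \<and> (\<forall>x\<in>set (tl p). \<not> adj (Delta m n) VA x)"
  proof (intro ballI impI)
    fix p assume "p \<in> set (arms m l)" "p \<noteq> []"
    then have "\<exists>j\<in>{1..m}. p = map (Arm j) [1..<l+1]"
      unfolding arms_def by (force simp del: upt_Suc map_eq_conv)
    with \<open>p \<noteq> []\<close> obtain j where j: "j \<in> {1..m}" "p = map (Arm j) [1..<l+1]" "1 \<le> l"
      by (cases "l = 0") auto
    then have "p = Arm j 1 # map (Arm j) [2..<l+1]" by (simp add: upt_conv_Cons numeral_2_eq_2 del: upt_Suc)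
    then show "adj (Delta m n) VA (hd p) \<and> (\<forall>x\<in>set (tl p). \<not> adj (Delta m n) VA x)"
      using j by auto
  qed
  show "VA \<notin> \<Union> (set ` set (arms m l))" by (auto simp: set_arms)
qed (use assms paths_sep_arms in \<open>auto simp: set_arms\<close>)

lemma tree_on_Yhat:
  assumes "Yhat_tree (n + 1) VA VB (arms m (n + 1)) T"
  shows "tree_on (Delta m n) (verts (Yhat m (n + 1))) {} T"
  using assms
proof cases
  case (1 T U)
  have bl: "map butlast (arms m (n + 1)) = arms m n" by (simp add: arms_def)
  let ?V = "verts (Yhat m (n + 1))"
  have v: "?V - {VB} = insert VA {Arm j k | j k. j \<in> {1..m} \<and> k \<in> {1..n+1}} \<union> {}"
    "?V - insert VB (nbs (Delta m n) VB) = insert VA {Arm j k | j k. j \<in> {1..m} \<and> k \<in> {1..n}} \<union> {}"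
    by (auto simp: Yhat_def)
  have "tree_on (Delta m n) (?V - {VB}) {} T"
    unfolding v using 1 by (intro tree_on_star_arms) (auto simp: sep_def)
  moreover have "tree_on (Delta m n) (?V - insert VB (nbs (Delta m n) VB)) {} U"
    unfolding v using 1 bl by (intro tree_on_star_arms) (auto simp: sep_def)
  ultimately show ?thesis using 1 by (simp add: Yhat_def)
qed

lemma verts_Delta: "verts (Delta m n) =
  {VA, VB} \<union> {Arm j k | j k. j \<in> {1..m} \<and> k \<in> {1..n+1}} \<union> {Spoke k | k. k \<in> {1..n}}"
  by (auto simp: Delta_def Yhat_def)

lemma tree_on_comb:
  "comb_tree m n T \<Longrightarrow> tree_on (Delta m n) (verts (Delta m n)) {} T"
  "comb_branch m n k T \<Longrightarrow> tree_on (Delta m n)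
     (verts (Delta m n) - Spoke ` {1..<k} - insert (Spoke k) (nbs (Delta m n) (Spoke k))) {} T"
proof (induction rule: comb_tree_comb_branch.inducts)
  case (comb_0 R)
  then have "tree_on (Delta m 0) (verts (Yhat m 1)) {} R" using tree_on_Yhat[of 0] by simp
  then show ?case by (simp add: Delta_def)
next
  case (comb n D R)
  have "tree_on (Delta m n) (verts (Delta m n) - Spoke ` {1..<i}) {}
      (foldr (\<lambda>k U. Split (Spoke k) U (D k)) [i..<n+1] R)" if "1 \<le> i" "i \<le> n + 1" for i
    using that(2,1)
  proof (induction rule: inc_induct)
    case base
    have "verts (Delta m n) - Spoke ` {1..<n+1} = verts (Yhat m (n + 1))"
      by (auto simp: Delta_def Yhat_def)
    then show ?case using tree_on_Yhat comb by simp
  next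
    case (step i)
    have e: "verts (Delta m n) - Spoke ` {1..<i} - {Spoke i} = verts (Delta m n) - Spoke ` {1..<Suc i}"
      using step by (auto simp: less_Suc_eq)
    have "Spoke i \<in> verts (Delta m n) - Spoke ` {1..<i}" using step by (auto simp: verts_Delta)
    moreover have "[i..<n+1] = i # [Suc i..<n+1]" using step upt_conv_Cons by blast
    moreover have "tree_on (Delta m n)
      (verts (Delta m n) - Spoke ` {1..<i} - insert (Spoke i) (nbs (Delta m n) (Spoke i))) {} (D i)"
      using comb step by auto
    ultimately show ?case using step e by simp
  qed
  from this[of 1] show ?case by simp
next
  case (first n)
  then show ?case by (auto simp: verts_Delta)
next
  case (last n)
  then show ?case by (auto simp: verts_Delta)
next
  case (middle k n T R)
  have IH: "tree_on (Delta m (n - (k + 1))) (verts (Delta m (n - (k + 1)))) {} R"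
    using middle by blast
  let ?W = "shift k ` verts (Delta m (n - (k + 1)))"
  let ?S = "insert VA {Arm j i | j i. j \<in> {1..m} \<and> i \<in> {1..k - 1}}"
  have W: "?W = {Spoke (k + 1), VB} \<union> {Arm j i | j i. j \<in> {1..m} \<and> i \<in> {k+2..n+1}}
      \<union> {Spoke i | i. i \<in> {k+2..n}}"
  proof -
    have "Arm j i \<in> ?W" if "j \<in> {1..m}" "i \<in> {k+2..n+1}" for i j
      by (rule image_eqI[of _ _ "Arm j (i - (k + 1))"]) (use that middle in \<open>auto simp: verts_Delta\<close>)
    moreover have "Spoke i \<in> ?W" if "i \<in> {k+2..n}" for i
      by (rule image_eqI[of _ _ "Spoke (i - (k + 1))"]) (use that middle in \<open>auto simp: verts_Delta\<close>)
    moreover have "Spoke (k + 1) \<in> ?W"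
      by (rule image_eqI[of _ _ VA]) (auto simp: verts_Delta)
    moreover have "VB \<in> ?W"
      by (rule image_eqI[of _ _ VB]) (auto simp: verts_Delta)
    ultimately show ?thesis using middle by (auto simp: verts_Delta)
  qed
  have "tree_on (Delta m n) ?W (shift k ` {}) (map_mtree (shift k) R)"
  proof (rule tree_on_map[OF IH])
    show "inj_on (shift k) (verts (Delta m (n - (k + 1))))"
      by (auto simp: inj_on_def verts_Delta)
    show "\<forall>u\<in>verts (Delta m (n - (k + 1))). \<forall>v\<in>verts (Delta m (n - (k + 1))).
        adj (Delta m n) (shift k u) (shift k v) = adj (Delta m (n - (k + 1))) u v"
      using middle by (auto simp: verts_Delta)
  qed
  moreover have "tree_on (Delta m n) (?S \<union> ?W) ?W T"
    unfolding W using middle by (intro tree_on_star_arms) (auto simp: sep_def)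
  ultimately have "tree_on (Delta m n) (?S \<union> ?W) {} (graft T (map_mtree (shift k) R))"
    using tree_on_graft by fastforce
  moreover have "?S \<union> ?W = verts (Delta m n) - Spoke ` {1..<k} - insert (Spoke k) (nbs (Delta m n) (Spoke k))"
    unfolding W using middle by (auto simp: verts_Delta)
  ultimately show ?case by simp
qed

lemma comb_tree_imp_matching_tree:
  "comb_tree m n T \<Longrightarrow> matching_tree (Delta m n) {} {} T"
  using tree_on_comb(1)[of m n T]
  by (intro tree_on_imp_matching_tree simple_Delta) (auto simp: Ind_def)

lemma exists_comb_matching_tree: "\<exists>T. comb_matching_tree m n T"
  by (metis comb_matching_tree_def comb_tree_imp_matching_tree exists_comb_tree)

end

theory Submission
  imports Defs "HOL-Computational_Algebra.Polynomial"
begin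

text \<open>Give each matching tree the polynomial whose coefficient at \<open>s\<close> is the number of critical
  cells with \<open>s\<close> vertices. It can be read off the operations alone, and grafting becomes
  multiplication. The stars then contribute polynomials \<open>S\<^sub>l\<close> with \<open>S\<^sub>0 = 0\<close>, \<open>S\<^sub>1 = X\<close>,
  \<open>S\<^sub>2 = X\<^sup>m\<close> and \<open>S\<^bsub>l+3\<^esub> = X\<^sup>m S\<^sub>l\<close>, and the comb yields the convolution
  \<open>F\<^sub>n = S\<^bsub>n+1\<^esub> + X S\<^sub>n + X \<Sum>\<^sub>j S\<^sub>j F\<^bsub>n-2-j\<^esub>\<close>. In \<open>F\<^sub>n - X\<^sup>m F\<^bsub>n-3\<^esub>\<close> everything cancels except
  \<open>X (S\<^sub>1 F\<^bsub>n-3\<^esub> + S\<^sub>2 F\<^bsub>n-4\<^esub>)\<close>, which is the recurrence.\<close>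

section \<open>Counting critical cells by a polynomial\<close>

abbreviation X :: "int poly" where "X \<equiv> monom 1 1"

primrec cell_poly :: "'v mtree \<Rightarrow> int poly" where
  "cell_poly Leaf = 1"
| "cell_poly (Free p) = 0"
| "cell_poly (Force p v T) = X * cell_poly T"
| "cell_poly (Split v T U) = cell_poly T + X * cell_poly U"

lemma finite_critical_cells: "finite (critical_cells G A B T)"
  by (induction T arbitrary: A B) auto

text \<open>The second conjunct strengthens the induction: below \<open>Split v T U\<close> the
  cells from \<open>T\<close> avoid \<open>v\<close> and those from \<open>U\<close> contain it.
  Hence the two sets are disjoint and their sums add.\<close>

lemma sum_critical_cells:
  assumes "simple_graph G" "A \<in> Ind G" "A \<inter> B = {}" "\<forall>u\<in>A. nbs G u \<subseteq> B"
    "tree_on G (verts G - (A \<union> B)) {} T"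
  shows "(\<Sum>I\<in>critical_cells G A B T. monom 1 (card I)) = monom 1 (card A) * cell_poly T
    \<and> (\<forall>I\<in>critical_cells G A B T. A \<subseteq> I \<and> B \<inter> I = {})"
  using assms(2-)
proof (induction T arbitrary: A B)
  case Leaf
  then have "A \<in> faces_between G A B" by (auto simp: faces_between_def)
  with Leaf show ?case by auto
next
  case (Force p v T)
  have ns: "{q} \<notin> edges G" for q using assms(1) by (force simp: simple_graph_def)
  have v: "v \<in> verts G - (A \<union> B)" using Force.prems by auto
  have "finite A" using Force.prems(1) assms(1) by (auto simp: Ind_def simple_graph_def intro: finite_subset)
  then have "card (A \<union> {v}) = Suc (card A)" using v by simp
  moreover have "A \<union> {v} \<in> Ind G" "(A \<union> {v}) \<inter> (B \<union> nbs G v) = {}"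
    using Force.prems v ns by (auto simp: Ind_def nbs_def insert_commute)
  moreover have "verts G - (A \<union> {v} \<union> (B \<union> nbs G v)) = verts G - (A \<union> B) - insert v (nbs G v)"
    by auto
  ultimately show ?case
    using Force.prems Force.IH[of "A \<union> {v}" "B \<union> nbs G v"]
    by (auto simp: mult_monom mult.assoc[symmetric])
next
  case (Split v T U)
  have ns: "{q} \<notin> edges G" for q using assms(1) by (force simp: simple_graph_def)
  have v: "v \<in> verts G - (A \<union> B)" using Split.prems by auto
  have "finite A" using Split.prems(1) assms(1) by (auto simp: Ind_def simple_graph_def intro: finite_subset)
  then have c: "card (A \<union> {v}) = Suc (card A)" using v by simp
  have e: "verts G - (A \<union> {v} \<union> (B \<union> nbs G v)) = verts G - (A \<union> B) - insert v (nbs G v)"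
    "verts G - (A \<union> (B \<union> {v})) = verts G - (A \<union> B) - {v}"
    by auto
  have "A \<union> {v} \<in> Ind G" "(A \<union> {v}) \<inter> (B \<union> nbs G v) = {}"
    using Split.prems v ns by (auto simp: Ind_def nbs_def insert_commute)
  then have U: "(\<Sum>I\<in>critical_cells G (A \<union> {v}) (B \<union> nbs G v) U. monom 1 (card I))
      = monom 1 (card A) * (X * cell_poly U)"
    "\<forall>I\<in>critical_cells G (A \<union> {v}) (B \<union> nbs G v) U. insert v A \<subseteq> I \<and> B \<inter> I = {}"
    using Split.prems e c Split.IH(2)[of "A \<union> {v}" "B \<union> nbs G v"]
    by (auto simp: mult_monom mult.assoc[symmetric])
  have T: "(\<Sum>I\<in>critical_cells G A (B \<union> {v}) T. monom 1 (card I)) = monom 1 (card A) * cell_poly T"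
    "\<forall>I\<in>critical_cells G A (B \<union> {v}) T. A \<subseteq> I \<and> (B \<union> {v}) \<inter> I = {}"
    using Split.prems v e Split.IH(1)[of A "B \<union> {v}"] by auto
  have "critical_cells G A (B \<union> {v}) T \<inter> critical_cells G (A \<union> {v}) (B \<union> nbs G v) U = {}"
    unfolding disjoint_iff
  proof (intro allI impI notI)
    fix I assume "I \<in> critical_cells G A (B \<union> {v}) T" "I \<in> critical_cells G (A \<union> {v}) (B \<union> nbs G v) U"
    then have "v \<notin> I" "v \<in> I" using bspec[OF T(2)] bspec[OF U(2)] by auto
    then show False ..
  qed
  then have "(\<Sum>I\<in>critical_cells G A B (Split v T U). monom 1 (card I))
      = monom 1 (card A) * cell_poly (Split v T U)"
    using T(1) U(1) by (simp add: sum.union_disjoint finite_critical_cells distrib_left)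
  moreover have "\<forall>I\<in>critical_cells G A (B \<union> {v}) T. A \<subseteq> I \<and> B \<inter> I = {}"
    "\<forall>I\<in>critical_cells G (A \<union> {v}) (B \<union> nbs G v) U. A \<subseteq> I \<and> B \<inter> I = {}"
    using T(2) U(2) by simp_all
  ultimately show ?case by (simp add: ball_Un)
qed auto

lemma card_critical_cells:
  assumes "simple_graph G" "tree_on G (verts G) {} T"
  shows "int (card {I \<in> critical_cells G {} {} T. card I = s}) = coeff (cell_poly T) s"
proof -
  have "(\<Sum>I\<in>critical_cells G {} {} T. monom 1 (card I)) = cell_poly T"
    using sum_critical_cells[of G "{}" "{}" T] assms by (simp add: Ind_def)
  then have "coeff (cell_poly T) s = (\<Sum>I\<in>critical_cells G {} {} T. if card I = s then 1 else 0)"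
    by (simp add: coeff_sum flip: \<open>_ = cell_poly T\<close>)
  also have "\<dots> = (\<Sum>I\<in>{I \<in> critical_cells G {} {} T. card I = s}. 1)"
    by (rule sum.inter_filter[symmetric]) (rule finite_critical_cells)
  finally show ?thesis by simp
qed

lemma cell_poly_graft [simp]: "cell_poly (graft T U) = cell_poly T * cell_poly U"
  by (induction T) (simp_all add: algebra_simps)

lemma cell_poly_map [simp]: "cell_poly (map_mtree f T) = cell_poly T"
  by (induction T) simp_all

lemma cell_poly_foldr_Split:
  "cell_poly (foldr (\<lambda>k U. Split (f k) U (D k)) ks R)
    = cell_poly R + X * (\<Sum>k\<leftarrow>ks. cell_poly (D k))"
  by (induction ks) (simp_all add: algebra_simps)

section \<open>Paths and stars\<close>

fun path_poly :: "nat \<Rightarrow> int poly" where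
  "path_poly 0 = 1"
| "path_poly (Suc 0) = 0"
| "path_poly (Suc (Suc n)) = X * path_poly (n - 1)"

text \<open>Reversal preserves the length, so the choice of an end does not matter. The truncated
  \<open>n - 1\<close> in \<open>path_poly\<close> mirrors \<open>tl []\<close>: a path on two
  vertices gives \<open>X\<close>.\<close>

lemma cell_poly_path: "path_tree xs T \<Longrightarrow> cell_poly T = path_poly (length xs)"
  by (induction rule: path_tree.induct) simp_all

lemma path_poly_3: "path_poly (n + 3) = X * path_poly n"
  by (simp add: numeral_3_eq_3)

lemma cell_poly_paths:
  assumes "paths_tree ps T" "\<forall>p\<in>set ps. length p = l"
  shows "cell_poly T = path_poly l ^ length ps"
proof -
  obtain qs Ts where q: "mset qs = mset ps" "list_all2 path_tree qs Ts" "T = foldr graft Ts Leaf"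
    using assms(1) by (auto simp: paths_tree_def)
  have "cell_poly (foldr graft Ts Leaf) = path_poly l ^ length qs"
    if "list_all2 path_tree qs Ts" "\<forall>p\<in>set qs. length p = l"
    using that by (induction rule: list_all2_induct) (simp_all add: cell_poly_path)
  moreover have "set qs = set ps" "length qs = length ps"
    using q(1) by (metis set_mset_mset, metis size_mset)
  ultimately show ?thesis using q assms(2) by simp
qed

text \<open>For \<open>m \<ge> 1\<close> this is 0 or a single monomial: \<open>path_poly\<close>
  vanishes at arguments congruent to 1 modulo 3, which kills one of the two summands.\<close>

definition star_poly :: "nat \<Rightarrow> nat \<Rightarrow> int poly" where
  "star_poly m n = (if n mod 3 = 0 then 0 else path_poly n ^ m + X * path_poly (n - 1) ^ m)"

lemma cell_poly_tendril_steps: "cell_poly U = 0 \<Longrightarrow> cell_poly (tendril_steps xs U) = 0"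
  by (induction xs U rule: tendril_steps.induct) simp_all

lemma cell_poly_star:
  assumes "star_tree n c ps T" "\<forall>p\<in>set ps. length p = n" "length ps = m"
  shows "cell_poly T = star_poly m n"
  using assms(1)
proof cases
  case (1 qs)
  have "cell_poly (foldr (\<lambda>q. tendril_steps (rev q)) qs (Free c)) = 0"
    by (induction qs) (simp_all add: cell_poly_tendril_steps)
  then show ?thesis using 1 by (simp add: star_poly_def)
next
  case (2 T U)
  have "cell_poly T = path_poly n ^ m" "cell_poly U = path_poly (n - 1) ^ m"
    using cell_poly_paths[OF 2(3)] cell_poly_paths[OF 2(4), of "n - 1"] assms by auto
  then show ?thesis using 2 by (simp add: star_poly_def)
qed

lemma star_poly_3: "star_poly m (n + 3) = X ^ m * star_poly m n"
\<comment> \<open>At \<open>n = 0\<close> the term \<open>n - 1\<close> truncates and does not shift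
  by 3, but both sides are 0.\<close>
proof (cases n)
  case (Suc k)
  have "path_poly (n + 3) = X * path_poly n" "path_poly (n + 3 - 1) = X * path_poly (n - 1)"
    using path_poly_3[of n] path_poly_3[of k] Suc by (simp_all add: add.commute)
  then show ?thesis by (simp add: star_poly_def power_mult_distrib algebra_simps)
qed (simp add: star_poly_def)

lemma star_poly_simps:
  assumes "m \<ge> 1"
  shows "star_poly m 0 = 0" "star_poly m 1 = X" "star_poly m 2 = X ^ m"
  using assms by (simp_all add: star_poly_def numeral_2_eq_2 power_0_left)

lemma length_arms: "length (arms m n) = m" "p \<in> set (arms m n) \<Longrightarrow> length p = n"
  by (auto simp: arms_def)

lemma cell_poly_star_arms:
  "star_tree n c (arms m n) T \<Longrightarrow> cell_poly T = star_poly m n"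
  by (erule cell_poly_star) (simp_all add: length_arms)

definition Yhat_poly :: "nat \<Rightarrow> nat \<Rightarrow> int poly" where
  "Yhat_poly m n = star_poly m n + X * star_poly m (n - 1)"

lemma cell_poly_Yhat:
  assumes "Yhat_tree n a b (arms m n) T"
  shows "cell_poly T = Yhat_poly m n"
  using assms
proof cases
  case (1 T U)
  have "cell_poly U = star_poly m (n - 1)"
    using cell_poly_star[OF 1(3)] by (simp add: length_arms)
  then show ?thesis using 1 cell_poly_star_arms[OF 1(2)] by (simp add: Yhat_poly_def)
qed

lemma Yhat_poly_3: "n \<ge> 1 \<Longrightarrow> Yhat_poly m (n + 3) = X ^ m * Yhat_poly m n"
  using star_poly_3[of m n] star_poly_3[of m "n - 1"] by (simp add: Yhat_poly_def algebra_simps)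

section \<open>The recurrence and the comb\<close>

text \<open>The claimed initial values and recurrence in terms of polynomials. A
  \<open>d\<close>-cell has \<open>d + 1\<close> vertices, so the initial exponents exceed the
  dimensions by one; a factor \<open>X ^ a\<close> shifts \<open>d\<close> by
  \<open>a\<close>.\<close>

fun comb_poly :: "nat \<Rightarrow> nat \<Rightarrow> int poly" where
  "comb_poly m 0 = X"
| "comb_poly m (Suc 0) = X ^ 2 + X ^ m"
| "comb_poly m (Suc (Suc 0)) = X ^ (m + 1)"
| "comb_poly m (Suc (Suc (Suc 0))) = X ^ 3 + X ^ (m + 1)"
| "comb_poly m (Suc (Suc (Suc (Suc n)))) =
    X ^ 2 * comb_poly m (Suc n) + X ^ (m + 1) * comb_poly m n + X ^ m * comb_poly m (Suc n)"

text \<open>The right-hand side is what the comb produces: \<open>Yhat_poly\<close> comes from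
  discarding all spokes, and the summand \<open>j\<close> from selecting spoke
  \<open>j + 1\<close>.\<close>

lemma comb_poly_convolution:
  assumes "m \<ge> 1"
  shows "comb_poly m n = Yhat_poly m (n + 1)
    + X * (\<Sum>j<n - 1. star_poly m j * comb_poly m (n - 2 - j))"
proof -
  have S: "star_poly m 0 = 0" "star_poly m (Suc 0) = X" "star_poly m (Suc (Suc 0)) = X ^ m"
    using star_poly_simps[OF assms] by (simp_all add: numeral_2_eq_2)
  have S3: "star_poly m (Suc (Suc (Suc n))) = X ^ m * star_poly m n" for n
    using star_poly_3[of m n] by (simp add: numeral_3_eq_3)
  show ?thesis
  proof (induction n rule: less_induct)
    case (less n)
    consider "n = 0" | "n = 1" | "n = 2" | "n = 3" | "n \<ge> 4" by linarith
    then show ?case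
    proof cases
      case 5
      then obtain k where k: "n = k + 4" by (metis add.commute le_Suc_ex)
      have "Yhat_poly m (k + 5) = X ^ m * Yhat_poly m (k + 2)"
        using Yhat_poly_3[of "k + 2" m] by (simp add: numeral_eq_Suc)
      \<comment> \<open>The terms for \<open>j = 0, 1, 2\<close> are split off, the first being 0.
        In the others \<open>j\<close> is replaced by \<open>j + 3\<close>, which yields the factor
        \<open>X ^ m\<close> and the sum occurring in the formula for \<open>k + 1\<close>.\<close>
      moreover have "(\<Sum>j<k + 3. star_poly m j * comb_poly m (k + 2 - j)) =
          X * comb_poly m (k + 1) + X ^ m * comb_poly m k
          + X ^ m * (\<Sum>j<k. star_poly m j * comb_poly m (k - 1 - j))"
        by (simp add: numeral_3_eq_3 sum.lessThan_Suc_shift S S3 sum_distrib_left mult.assoc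
            del: sum.lessThan_Suc)
      moreover have "comb_poly m (k + 4) =
          X ^ 2 * comb_poly m (k + 1) + X ^ (m + 1) * comb_poly m k + X ^ m * comb_poly m (k + 1)"
        by (simp add: numeral_eq_Suc)
      moreover have "comb_poly m (k + 1) = Yhat_poly m (k + 2)
          + X * (\<Sum>j<k. star_poly m j * comb_poly m (k - 1 - j))"
        using less[of "k + 1"] k by simp
      ultimately have "comb_poly m (k + 4) = Yhat_poly m (k + 5)
          + X * (\<Sum>j<k + 3. star_poly m j * comb_poly m (k + 2 - j))"
        by (simp add: algebra_simps power2_eq_square)
      moreover have "k + 4 + 1 = k + 5" "k + 4 - 1 = k + 3" "k + 4 - 2 = k + 2" by simp_all
      ultimately show ?thesis using k by metis
    qed (simp_all add: Yhat_poly_def S S3 numeral_2_eq_2 numeral_3_eq_3 algebra_simps)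
  qed
qed

text \<open>The two \<open>Free\<close> branches have no critical cells and fit the same formula:
  for \<open>k = 1\<close> because \<open>star_poly m 0 = 0\<close>, for \<open>k = n\<close> by the
  value 0 of the second alternative.\<close>

lemma cell_poly_comb:
  assumes "m \<ge> 1"
  shows "comb_tree m n T \<Longrightarrow> cell_poly T = comb_poly m n"
    and "comb_branch m n k T \<Longrightarrow> k \<ge> 1 \<and> cell_poly T =
      (if k < n then star_poly m (k - 1) * comb_poly m (n - (k + 1)) else 0)"
proof (induction rule: comb_tree_comb_branch.inducts)
  case (comb_0 R)
  then show ?case
    using cell_poly_Yhat[of 1 VA VB m] comb_poly_convolution[OF assms, of 0] by simp
next
  case (comb n D R)
  let ?b = "\<lambda>j. star_poly m j * comb_poly m (n - 2 - j)"
  have "(\<Sum>k\<leftarrow>[1..<n+1]. cell_poly (D k)) = (\<Sum>k=1..<n+1. cell_poly (D k))"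
    by (simp add: sum_list_distinct_conv_sum_set del: upt_Suc)
  also have "\<dots> = (\<Sum>j<n. cell_poly (D (Suc j)))"
    using sum.shift_bounds_Suc_ivl[of "\<lambda>k. cell_poly (D k)" 0 n] by (simp add: lessThan_atLeast0 del: sum.op_ivl_Suc)
  \<comment> \<open>With \<open>k = Suc j\<close> the condition \<open>k < n\<close> reads
    \<open>j < n - 1\<close>, and \<open>n - (k + 1)\<close> is \<open>n - 2 - j\<close>.\<close>
  also have "\<dots> = (\<Sum>j<n. if j < n - 1 then ?b j else 0)"
    by (rule sum.cong) (use comb in \<open>auto simp: less_diff_conv\<close>)
  also have "\<dots> = (\<Sum>j<n - 1. ?b j)"
    by (rule sum.mono_neutral_cong_right) auto
  finally show ?case
    using comb cell_poly_Yhat[of "n + 1" VA VB m] comb_poly_convolution[OF assms, of n]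
    by (simp add: cell_poly_foldr_Split del: upt_Suc)
next
  case (first n)
  then show ?case using star_poly_simps[OF assms] by simp
next
  case (middle k n T R)
  then show ?case using cell_poly_star_arms[of "k - 1"] by simp
qed simp

section \<open>From coefficients to cell counts\<close>

lemma C_eq:
  assumes "m \<ge> 1" "n \<ge> 1 \<Longrightarrow> comb_matching_tree m n (T n)" "d \<ge> 0"
  shows "C m T d (int n) = coeff (comb_poly m n) (nat (d + 1))"
proof (cases "n = 0")
  case True
  have "nat (d + 1) = 1 \<longleftrightarrow> d = 0" by auto
  then show ?thesis using True assms(3) by (auto simp: C_def X_num_cells_def)
next
  case False
  define K where "K = critical_cells (Delta m n) {} {} (T n)"
  have K: "finite K" by (simp add: K_def finite_critical_cells)
  have comb: "comb_tree m n (T n)" using assms(2) False by (simp add: comb_matching_tree_def)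
  have "face_dim I = d \<longleftrightarrow> card I = nat (d + 1)" for I :: "vert set"
    using assms(3) by (simp add: face_dim_def nat_eq_iff2) linarith
  then have "{c \<in> Critical ` K. cell_dim c = d} = Critical ` {I \<in> K. card I = nat (d + 1)}"
    by (simp only: Compr_image_eq cell_dim.simps)
  then have "card {c \<in> Critical ` K. cell_dim c = d} = card {I \<in> K. card I = nat (d + 1)}"
    by (simp add: card_image inj_on_def)
  \<comment> \<open>\<open>Base\<close> adds one cell exactly in dimension 0, where \<open>C\<close>
    subtracts one.\<close>
  moreover have "{c \<in> insert Base (Critical ` K). cell_dim c = d} =
      (if d = 0 then insert Base {c \<in> Critical ` K. cell_dim c = d} else {c \<in> Critical ` K. cell_dim c = d})"
    by (rule set_eqI) auto
  ultimately have "int (X_num_cells m T d n)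
      = (if d = 0 then 1 else 0) + int (card {I \<in> K. card I = nat (d + 1)})"
    using False K by (cases "d = 0") (simp_all add: X_num_cells_def image_iff flip: K_def)
  then show ?thesis
    using assms(1,3) card_critical_cells[OF simple_Delta tree_on_comb(1)[OF comb]]
      cell_poly_comb(1)[OF _ comb] by (simp add: C_def K_def)
qed

text \<open>This matches the convention that \<open>C\<close> is 0 in dimension -1: the constant
  coefficient would count the empty face.\<close>

lemma coeff_comb_poly_0: "m \<ge> 1 \<Longrightarrow> coeff (comb_poly m n) 0 = 0"
  by (induction m n rule: comb_poly.induct) (simp_all add: coeff_0_power coeff_mult_0)

theorem theorem4p2:
  fixes m :: nat and T :: "nat \<Rightarrow> vert mtree"
  assumes "m \<ge> 2"
    and "\<And>n. n \<ge> 1 \<Longrightarrow> comb_matching_tree m n (T n)"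
  shows "(m = 2 \<longrightarrow> (\<forall>d::int. d \<ge> 0 \<longrightarrow>
            C m T d 0 = (if d = 0 then 1 else 0) \<and>
            C m T d 1 = (if d = 1 then 2 else 0) \<and>
            C m T d 2 = (if d = 2 then 1 else 0) \<and>
            C m T d 3 = (if d = 2 then 2 else 0))) \<and>
         (m \<ge> 3 \<longrightarrow> (\<forall>d::int. d \<ge> 0 \<longrightarrow>
            C m T d 0 = (if d = 0 then 1 else 0) \<and>
            C m T d 1 = (if d = 1 \<or> d = int m - 1 then 1 else 0) \<and>
            C m T d 2 = (if d = int m then 1 else 0) \<and>
            C m T d 3 = (if d = 2 \<or> d = int m then 1 else 0))) \<and>
         (\<forall>(n::int) (d::int). n \<ge> 4 \<longrightarrow> d \<ge> 0 \<longrightarrow>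
            C m T d n = C m T (d - 2) (n - 3) + C m T (d - (int m + 1)) (n - 4)
                        + C m T (d - int m) (n - 3))"
proof -
  have C: "C m T d (int n) = coeff (comb_poly m n) (nat (d + 1))" if "d \<ge> 0" for d n
    using C_eq assms that by simp
  have nat: "s = nat (d + 1) \<longleftrightarrow> d = int s - 1" if "d \<ge> 0" for d s
    using that by auto
  \<comment> \<open>Sums of indicators treat both cases at once: for \<open>m = 2\<close> the two
    dimensions coincide and give 2, for \<open>m \<ge> 3\<close> they differ.\<close>
  have init: "C m T d 0 = (if d = 0 then 1 else 0)"
    "C m T d 1 = (if d = 1 then 1 else 0) + (if d = int m - 1 then 1 else 0)"
    "C m T d 2 = (if d = int m then 1 else 0)"
    "C m T d 3 = (if d = 2 then 1 else 0) + (if d = int m then 1 else 0)" if "d \<ge> 0" for d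
    using C[OF that, of 0] C[OF that, of 1] C[OF that, of 2] C[OF that, of 3] nat[OF that]
    by (simp_all add: numeral_2_eq_2 numeral_3_eq_3 monom_power mult_monom)
  have shift: "coeff (X ^ a * comb_poly m n) (nat (d + 1)) = C m T (d - int a) (int n)"
    if "d \<ge> 0" for a n d
  proof -
    \<comment> \<open>In the boundary case \<open>int a = d + 1\<close> the constant coefficient of
      \<open>comb_poly m n\<close> is read off; beyond it the factor \<open>X ^ a\<close> forces
      0.\<close>
    consider "int a \<le> d" | "int a = d + 1" | "int a > d + 1" by linarith
    then show ?thesis
    proof cases
      case 1
      then have "nat (d + 1) - a = nat (d - int a + 1)" by auto
      with 1 show ?thesis by (simp add: C monom_power coeff_monom_mult)
    next
      case 2
      then have "nat (d + 1) = a" by simp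
      with 2 assms(1) show ?thesis
        by (simp add: C_def monom_power coeff_monom_mult coeff_comb_poly_0)
    next
      case 3
      then have "nat (d + 1) < a" using that by linarith
      with 3 show ?thesis by (simp add: C_def monom_power coeff_monom_mult)
    qed
  qed
  have "C m T d n = C m T (d - 2) (n - 3) + C m T (d - (int m + 1)) (n - 4) + C m T (d - int m) (n - 3)"
    if "n \<ge> 4" "d \<ge> 0" for n d
  proof -
    define k where "k = nat (n - 4)"
    have n: "n = int (Suc (Suc (Suc (Suc k))))" "n - 3 = int (Suc k)" "n - 4 = int k"
      using that by (simp_all add: k_def)
    show ?thesis
      unfolding n(2,3) using shift[OF that(2), of 2] shift[OF that(2), of m]
        shift[OF that(2), of "m + 1"] C[OF that(2), of "Suc (Suc (Suc (Suc k)))"]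
      by (simp add: n(1) add.commute)
  qed
  then show ?thesis
    using init by auto
qed

end
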